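(* Let $\beta_0=\{q_0,q_1,q_2,p_0,p_1,p_2\}$ with $p_2=F_2F_1q_0$, $p_1=F_1F_0q_2$, $p_0=F_0F_2q_1$, and $\beta_m=\bigcup_{i=0}^2F_i\beta_{m-1}$ for $m\ge1$. Let $\tilde c_{\tilde x,\tilde y}$ be the conductances of $\beta_0$, and, for $m>0$, let $c_{x,y}$ be the conductances of $\beta_m$. Let $x\neq y$ be points of $\beta_m$, $m>0$. If $x$ and $y$ are in different $m$-cells (i.e. no $m$-cell contains both), then $c_{x,y}=0$. If $x=F_w(\tilde x)$ and $y=F_w(\tilde y)$ for some word $w$ with $|w|=m$ and $\tilde x,\tilde y\in\beta_0$, then $$c_{x,y}=\left(\tfrac53\right)^m\tilde c_{\tilde x,\tilde y}.$$
   Context: Let $q_0,q_1,q_2$ be the vertices of an equilateral triangle in the plane, $F_i(x)=\frac12(x+q_i)$, and let $SG$ (the Sierpinski gasket) be the unique nonempty compact set with $SG=\bigcup_{i}F_i(SG)$. For a word $w$ of length $|w|=m$ let $F_w=F_{w_1}\circ\cdots\circ F_{w_m}$; the sets $F_wSG$, $|w|=m$, are the $m$-cells. Put $V_0=\{q_0,q_1,q_2\}$, $V_m=\bigcup_iF_iV_{m-1}$; $x\sim_m y$ means $x\ne y$ and $x,y\in F_wV_0$ for some word $w$ of length $m$. The energy of a continuous $u:SG\to\mathbb{R}$ is $\mathcal{E}(u)=\lim_{m\to\infty}\left(\frac53\right)^m\sum_{\{x,y\}:x\sim_m y}(u(x)-u(y))^2$ (a nondecreasing limit), and $\operatorname{dom}\mathcal{E}$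 is the set of continuous $u$ with $\mathcal{E}(u)<\infty$. For a nonempty finite set $A\subset\bigcup_kV_k$ and values prescribed on $A$, there is a unique $u\in\operatorname{dom}\mathcal{E}$ of least energy with these values on $A$, and its energy has the form $\mathcal{E}(u)=\sum_{\{x,y\}\subset A}c_{x,y}(u(x)-u(y))^2$; the (uniquely determined, symmetric) coefficients $c_{x,y}$, $x\neq y$, are the conductances of $A$. *)

theory Defs
  imports "HOL-Analysis.Analysis"
begin

text \<open>
  The indices 0, 1, 2 are the elements of the three-element type \<^typ>\<open>3\<close>
  (in which the numeral 3 denotes 0). A vertex map \<open>q\<close> is an explicit parameter of all notions.
\<close>

definition equilateral :: "(3 \<Rightarrow> real^2) \<Rightarrow> bool" where
  "equilateral q \<longleftrightarrow> q 0 \<noteq> q 1 \<and>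
     dist (q 0) (q 1) = dist (q 1) (q 2) \<and> dist (q 1) (q 2) = dist (q 2) (q 0)"

definition F :: "(3 \<Rightarrow> real^2) \<Rightarrow> 3 \<Rightarrow> real^2 \<Rightarrow> real^2" where
  "F q i x = (1/2) *\<^sub>R (x + q i)"

primrec Fword :: "(3 \<Rightarrow> real^2) \<Rightarrow> 3 list \<Rightarrow> real^2 \<Rightarrow> real^2" where
  "Fword q [] = id"
| "Fword q (i # w) = F q i \<circ> Fword q w"

definition SG :: "(3 \<Rightarrow> real^2) \<Rightarrow> (real^2) set" where
  "SG q = (THE K. K \<noteq> {} \<and> compact K \<and> K = (\<Union>i. F q i ` K))"

definition cell :: "(3 \<Rightarrow> real^2) \<Rightarrow> 3 list \<Rightarrow> (real^2) set" where
  "cell q w = Fword q w ` SG q"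

primrec V :: "(3 \<Rightarrow> real^2) \<Rightarrow> nat \<Rightarrow> (real^2) set" where
  "V q 0 = {q 0, q 1, q 2}"
| "V q (Suc m) = (\<Union>i. F q i ` V q m)"

definition adj :: "(3 \<Rightarrow> real^2) \<Rightarrow> nat \<Rightarrow> real^2 \<Rightarrow> real^2 \<Rightarrow> bool" where
  "adj q m x y \<longleftrightarrow> x \<noteq> y \<and>
     (\<exists>w. length w = m \<and> x \<in> Fword q w ` V q 0 \<and> y \<in> Fword q w ` V q 0)"

text \<open>
  Sums over unordered pairs \<open>{x, y}\<close> of a symmetric summand are written as half the sum over
  ordered pairs, here and in \<open>is_conductances\<close> below.
\<close>

definition graph_energy :: "(3 \<Rightarrow> real^2) \<Rightarrow> nat \<Rightarrow> (real^2 \<Rightarrow> real) \<Rightarrow> real" where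
  "graph_energy q m u =
     (5/3) ^ m * ((\<Sum>(x, y) \<in> {(x, y). adj q m x y}. (u x - u y)\<^sup>2) / 2)"

text \<open>
  A function on the gasket is represented by a total function on the plane; only its values on
  \<open>SG q\<close> enter the definitions.
\<close>

definition energy :: "(3 \<Rightarrow> real^2) \<Rightarrow> (real^2 \<Rightarrow> real) \<Rightarrow> ereal" where
  "energy q u = lim (\<lambda>m. ereal (graph_energy q m u))"

definition dom_energy :: "(3 \<Rightarrow> real^2) \<Rightarrow> (real^2 \<Rightarrow> real) set" where
  "dom_energy q = {u. continuous_on (SG q) u \<and> energy q u < \<infinity>}"

definition least_energy_extension ::
  "(3 \<Rightarrow> real^2) \<Rightarrow> (real^2) set \<Rightarrow> (real^2 \<Rightarrow> real) \<Rightarrow> (real^2 \<Rightarrow> real) \<Rightarrow> bool" where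
  "least_energy_extension q A a u \<longleftrightarrow>
     u \<in> dom_energy q \<and> (\<forall>x\<in>A. u x = a x) \<and>
     (\<forall>v\<in>dom_energy q. (\<forall>x\<in>A. v x = a x) \<longrightarrow> energy q u \<le> energy q v)"

text \<open>
  Only the values of \<open>c\<close> at distinct points of \<open>A\<close> are meaningful; the others are set to 0 so
  that \<open>c\<close> is unique as a total function.
\<close>

definition is_conductances ::
  "(3 \<Rightarrow> real^2) \<Rightarrow> (real^2) set \<Rightarrow> (real^2 \<Rightarrow> real^2 \<Rightarrow> real) \<Rightarrow> bool" where
  "is_conductances q A c \<longleftrightarrow>
     (\<forall>x y. c x y = c y x) \<and>
     (\<forall>x y. \<not> (x \<in> A \<and> y \<in> A \<and> x \<noteq> y) \<longrightarrow> c x y = 0) \<and>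
     (\<forall>a u. least_energy_extension q A a u \<longrightarrow>
        energy q u = ereal ((\<Sum>x\<in>A. \<Sum>y\<in>A. c x y * (u x - u y)\<^sup>2) / 2))"

definition conductance ::
  "(3 \<Rightarrow> real^2) \<Rightarrow> (real^2) set \<Rightarrow> real^2 \<Rightarrow> real^2 \<Rightarrow> real" where
  "conductance q A = (THE c. is_conductances q A c)"

primrec beta :: "(3 \<Rightarrow> real^2) \<Rightarrow> nat \<Rightarrow> (real^2) set" where
  "beta q 0 = {q 0, q 1, q 2,
     F q 0 (F q 2 (q 1)), F q 1 (F q 0 (q 2)), F q 2 (F q 1 (q 0))}"
| "beta q (Suc m) = (\<Union>i. F q i ` beta q m)"

end

theory Submission
  imports Defs
begin

text \<open>
  The energy is self-similar: \<open>E(u) = 5/3 \<Sum>\<^sub>i E(u \<circ> F\<^sub>i)\<close>. If a finite set \<open>A\<close> of vertices contains the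
  three corners, functions prescribed on the cells \<open>F\<^sub>i A\<close> can be glued, so a function is a least
  energy extension from \<open>\<Union>\<^sub>i F\<^sub>i A\<close> only if its restriction to every cell is one from \<open>A\<close>. The
  conductances of \<open>\<Union>\<^sub>i F\<^sub>i A\<close> are therefore 5/3 times those of \<open>A\<close>, copied into each cell, and the
  claim follows by induction on \<open>m\<close>. The conductances of \<open>A \<subseteq> V\<^sub>k\<close> exist because
  the vertices of \<open>V\<^sub>k\<close> outside \<open>A\<close> can be eliminated one at a time by the star-mesh transformation
  and every function on \<open>V\<^sub>k\<close> extends to the gasket by piecewise harmonic functions without
  increase of energy; they are unique because every boundary function on \<open>A\<close> has such an extension.
\<close>

section \<open>Finite electrical networks\<close>

definition network_energy :: "('a \<Rightarrow> 'a \<Rightarrow> real) \<Rightarrow> 'a set \<Rightarrow> ('a \<Rightarrow> real) \<Rightarrow> real" where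
  "network_energy c A u = (\<Sum>x\<in>A. \<Sum>y\<in>A. c x y * (u x - u y)\<^sup>2) / 2"

lemma network_energy_cong:
  assumes "\<And>x. x \<in> A \<Longrightarrow> u x = v x"
  shows "network_energy c A u = network_energy c A v"
  unfolding network_energy_def using assms by (simp cong: sum.cong)

text \<open>By symmetry the row and the column of \<open>z\<close> contribute equally, which cancels
  the factor 1/2.\<close>

lemma network_energy_insert:
  assumes "finite B" "z \<notin> B" "\<And>x y. c x y = c y x"
  shows "network_energy c (insert z B) u
    = network_energy c B u + (\<Sum>x\<in>B. c x z * (u x - u z)\<^sup>2)"
proof -
  have "(\<Sum>y\<in>B. c z y * (u z - u y)\<^sup>2) = (\<Sum>x\<in>B. c x z * (u x - u z)\<^sup>2)"
    using assms(3) by (intro sum.cong) (auto simp: power2_commute)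
  then show ?thesis
    using assms(1,2) by (simp add: network_energy_def sum.distrib add_divide_distrib)
qed

text \<open>The left side is a quadratic in \<open>t\<close>, minimal at the weighted mean. Its
  minimum is the weighted variance, written as a sum over pairs; the pair weights
  \<open>k x * k y / s\<close> are what a mesh replacing a star with edge weights \<open>k\<close>
  must carry.\<close>

lemma weighted_variance:
  fixes k u :: "'a \<Rightarrow> real"
  assumes "finite B" and s: "s = (\<Sum>x\<in>B. k x)" "s \<noteq> 0"
  shows "(\<Sum>x\<in>B. k x * (u x - t)\<^sup>2)
    = s * (t - (\<Sum>x\<in>B. k x * u x) / s)\<^sup>2
      + (\<Sum>x\<in>B. \<Sum>y\<in>B. k x * k y / s * (u x - u y)\<^sup>2) / 2"
proof -
  define p where "p = (\<Sum>x\<in>B. k x * u x)"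
  define r where "r = (\<Sum>x\<in>B. k x * (u x)\<^sup>2)"
  have "(\<Sum>x\<in>B. k x * (u x - t)\<^sup>2)
      = (\<Sum>x\<in>B. k x * (u x)\<^sup>2 - 2 * t * (k x * u x) + t\<^sup>2 * k x)"
    by (intro sum.cong) (auto simp: power2_eq_square algebra_simps)
  also have "\<dots> = r - 2 * t * p + t\<^sup>2 * s"
    by (simp add: sum.distrib sum_subtractf sum_distrib_left r_def p_def s)
  finally have 1: "(\<Sum>x\<in>B. k x * (u x - t)\<^sup>2) = r - 2 * t * p + t\<^sup>2 * s" .
  have "(\<Sum>x\<in>B. \<Sum>y\<in>B. k x * k y / s * (u x - u y)\<^sup>2)
      = (\<Sum>x\<in>B. \<Sum>y\<in>B. (k x * (u x)\<^sup>2 * k y + k x * (k y * (u y)\<^sup>2)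
          - 2 * ((k x * u x) * (k y * u y))) / s)"
    by (intro sum.cong) (auto simp: power2_eq_square algebra_simps diff_divide_distrib add_divide_distrib)
  also have "\<dots> = (r * s + s * r - 2 * (p * p)) / s"
    by (simp add: r_def p_def s(1) sum_divide_distrib[symmetric] sum.distrib sum_subtractf
        sum_distrib_left[symmetric] sum_distrib_right[symmetric])
  finally have 2: "(\<Sum>x\<in>B. \<Sum>y\<in>B. k x * k y / s * (u x - u y)\<^sup>2)
      = (r * s + s * r - 2 * (p * p)) / s" .
  show ?thesis
    unfolding 1 2 p_def[symmetric] using s(2)
    by (simp add: field_simps power2_eq_square)
qed

text \<open>Star-mesh transformation: completing the square in the value at \<open>z\<close>.\<close>

lemma network_eliminate_node:
  fixes c :: "'a \<Rightarrow> 'a \<Rightarrow> real"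
  assumes "finite B" "z \<notin> B" and sym: "\<And>x y. c x y = c y x" and nonneg: "\<And>x y. 0 \<le> c x y"
  obtains c' :: "'a \<Rightarrow> 'a \<Rightarrow> real"
  where "\<And>x y. c' x y = c' y x" "\<And>x y. 0 \<le> c' x y"
    "\<And>u. network_energy c' B u \<le> network_energy c (insert z B) u"
    "\<And>u. \<exists>t. network_energy c (insert z B) (u(z := t)) = network_energy c' B u"
proof -
  define s where "s = (\<Sum>x\<in>B. c x z)"
  define c' where "c' x y = c x y + c x z * c y z / s" for x y
  have s0: "0 \<le> s" unfolding s_def using nonneg by (simp add: sum_nonneg)
  have c'_sym: "c' x y = c' y x" for x y
    by (simp add: c'_def sym[of x y] mult.commute)
  have c'_nonneg: "0 \<le> c' x y" for x y
    unfolding c'_def using nonneg s0 by (simp add: mult_nonneg_nonneg)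
  have split: "network_energy c' B u = network_energy c B u
      + (\<Sum>x\<in>B. \<Sum>y\<in>B. c x z * c y z / s * (u x - u y)\<^sup>2) / 2" for u
    by (simp add: network_energy_def c'_def sum.distrib distrib_right add_divide_distrib)
  have key: "network_energy c (insert z B) u
      = network_energy c' B u + s * (u z - (\<Sum>x\<in>B. c x z * u x) / s)\<^sup>2" for u
  \<comment> \<open>If \<open>s = 0\<close>, then \<open>z\<close> has no edge to \<open>B\<close>,
    and the added mesh terms vanish because division by zero gives 0.\<close>
  proof (cases "s = 0")
    case True
    then have "\<forall>x\<in>B. c x z = 0"
      unfolding s_def using nonneg \<open>finite B\<close> by (simp add: sum_nonneg_eq_0_iff)
    then show ?thesis
      using True network_energy_insert[OF assms(1,2), of c u] sym by (simp add: split)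
  next
    case False
    have "network_energy c (insert z B) u
        = network_energy c B u + (\<Sum>x\<in>B. c x z * (u x - u z)\<^sup>2)"
      using network_energy_insert[OF assms(1,2), of c u] sym by simp
    then show ?thesis
      using weighted_variance[OF assms(1) s_def False, of u "u z"] by (simp add: split)
  qed
  show ?thesis
  proof (rule that[of c'])
    show "network_energy c' B u \<le> network_energy c (insert z B) u" for u
      using s0 by (simp add: key)
    show "\<exists>t. network_energy c (insert z B) (u(z := t)) = network_energy c' B u" for u
    proof
      \<comment> \<open>The weighted mean makes the square in \<open>key\<close> vanish, so the
        bound is attained.\<close>
      define t where "t = (\<Sum>x\<in>B. c x z * u x) / s"
      have "(\<Sum>x\<in>B. c x z * (u(z := t)) x) = (\<Sum>x\<in>B. c x z * u x)"
        using assms(2) by (intro sum.cong) auto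
      moreover have "network_energy c' B (u(z := t)) = network_energy c' B u"
        using assms(2) by (intro network_energy_cong) auto
      ultimately show "network_energy c (insert z B) (u(z := t)) = network_energy c' B u"
        by (simp add: key t_def)
    qed
  qed (fact c'_sym c'_nonneg)+
qed

text \<open>The last two properties say that \<open>network_energy c' A a\<close> is the minimum of
  the energy over all extensions of \<open>a\<close> to \<open>B\<close>. The nodes of
  \<open>B - A\<close> are eliminated one by one.\<close>

lemma network_trace:
  fixes c :: "'a \<Rightarrow> 'a \<Rightarrow> real"
  assumes "finite B" "A \<subseteq> B" and sym: "\<And>x y. c x y = c y x" and nonneg: "\<And>x y. 0 \<le> c x y"
  obtains c' :: "'a \<Rightarrow> 'a \<Rightarrow> real"
  where "\<And>x y. c' x y = c' y x"
    "\<And>x y. \<not> (x \<in> A \<and> y \<in> A \<and> x \<noteq> y) \<Longrightarrow> c' x y = 0"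
    "\<And>u. network_energy c' A u \<le> network_energy c B u"
    "\<And>a. \<exists>u. (\<forall>x\<in>A. u x = a x) \<and> network_energy c B u = network_energy c' A a"
proof -
  \<comment> \<open>Induction on the set \<open>D\<close> of nodes still to be eliminated;
    \<open>c\<close> must vary, since each elimination changes the conductances on the remaining
    nodes.\<close>
  have "\<exists>c'. (\<forall>x y. c' x y = c' y x)
      \<and> (\<forall>x y. \<not> (x \<in> A \<and> y \<in> A \<and> x \<noteq> y) \<longrightarrow> c' x y = 0)
      \<and> (\<forall>u. network_energy c' A u \<le> network_energy c (A \<union> D) u)
      \<and> (\<forall>a. \<exists>u. (\<forall>x\<in>A. u x = a x) \<and> network_energy c (A \<union> D) u = network_energy c' A a)"
    if "finite D" "A \<inter> D = {}" "\<And>x y. c x y = c y x" "\<And>x y. 0 \<le> c x y"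
    for D and c :: "'a \<Rightarrow> 'a \<Rightarrow> real"
    using that
  proof (induction D arbitrary: c rule: finite_induct)
    case empty
    \<comment> \<open>Clearing the diagonal and the entries outside \<open>A\<close> leaves the
      energy on \<open>A\<close> unchanged and makes \<open>c'\<close> canonical.\<close>
    define c' where "c' x y = (if x \<in> A \<and> y \<in> A \<and> x \<noteq> y then c x y else 0)" for x y
    have "network_energy c' A u = network_energy c A u" for u
      unfolding network_energy_def c'_def
      by (intro arg_cong[where f = "\<lambda>x. x / 2"] sum.cong) auto
    moreover have "c' x y = c' y x" for x y
      using empty by (auto simp: c'_def)
    moreover have "c' x y = 0" if "\<not> (x \<in> A \<and> y \<in> A \<and> x \<noteq> y)" for x y
      using that unfolding c'_def by (rule if_not_P)
    ultimately show ?case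
      by (intro exI[of _ c']) auto
  next
    case (insert z D)
    have z: "z \<notin> A \<union> D" and ins: "A \<union> insert z D = insert z (A \<union> D)"
      using insert by auto
    have "finite (A \<union> D)"
      using assms(1,2) insert.hyps(1) finite_subset by blast
    then obtain c1 where c1: "\<And>x y. c1 x y = c1 y x" "\<And>x y. 0 \<le> c1 x y"
      and le: "\<And>u. network_energy c1 (A \<union> D) u \<le> network_energy c (insert z (A \<union> D)) u"
      and eq: "\<And>u. \<exists>t. network_energy c (insert z (A \<union> D)) (u(z := t)) = network_energy c1 (A \<union> D) u"
      using network_eliminate_node[OF _ z, of c] insert.prems by blast
    obtain c' where c': "\<forall>x y. c' x y = c' y x"
      "\<forall>x y. \<not> (x \<in> A \<and> y \<in> A \<and> x \<noteq> y) \<longrightarrow> c' x y = 0"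
      "\<forall>u. network_energy c' A u \<le> network_energy c1 (A \<union> D) u"
      "\<forall>a. \<exists>u. (\<forall>x\<in>A. u x = a x) \<and> network_energy c1 (A \<union> D) u = network_energy c' A a"
      using insert.IH[of c1] insert.prems(1) c1 by auto
    have "\<exists>u. (\<forall>x\<in>A. u x = a x) \<and> network_energy c (insert z (A \<union> D)) u = network_energy c' A a" for a
    proof -
      obtain u where u: "\<forall>x\<in>A. u x = a x" "network_energy c1 (A \<union> D) u = network_energy c' A a"
        using c'(4) by blast
      obtain t where "network_energy c (insert z (A \<union> D)) (u(z := t)) = network_energy c1 (A \<union> D) u"
        using eq by blast
      then show ?thesis
        using u z by (intro exI[of _ "u(z := t)"]) auto
    qed
    then show ?case
      unfolding ins using c' le by (intro exI[of _ c']) (meson order_trans)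
  qed
  from this[of "B - A" c] assms have "\<exists>c'. (\<forall>x y. c' x y = c' y x)
      \<and> (\<forall>x y. \<not> (x \<in> A \<and> y \<in> A \<and> x \<noteq> y) \<longrightarrow> c' x y = 0)
      \<and> (\<forall>u. network_energy c' A u \<le> network_energy c B u)
      \<and> (\<forall>a. \<exists>u. (\<forall>x\<in>A. u x = a x) \<and> network_energy c B u = network_energy c' A a)"
    by (simp add: Un_absorb1)
  then show ?thesis using that by metis
qed

text \<open>Polarization with indicator functions: in \<open>N {x} + N {y} - N {x, y}\<close> the
  edges to third nodes cancel, while the edge between \<open>x\<close> and \<open>y\<close> is
  counted twice by the first two terms and not at all by the third.\<close>

lemma network_energy_inject:
  fixes c c' :: "'a \<Rightarrow> 'a \<Rightarrow> real"
  assumes "finite A" and eq: "\<And>u. network_energy c A u = network_energy c' A u"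
    and sym: "\<And>x y. c x y = c y x" "\<And>x y. c' x y = c' y x"
    and "x \<in> A" "y \<in> A" "x \<noteq> y"
  shows "c x y = c' x y"
proof -
  define N where "N S = network_energy (\<lambda>x y. c x y - c' x y) A (indicator S)" for S :: "'a set"
  have N0: "N S = 0" for S
    unfolding N_def using eq[of "indicator S"]
    by (simp add: network_energy_def left_diff_distrib sum_subtractf diff_divide_distrib)
  have pt: "(indicator {x} a - indicator {x} b)\<^sup>2 + (indicator {y} a - indicator {y} b)\<^sup>2
      - (indicator {x, y} a - indicator {x, y} b)\<^sup>2
      = (of_bool (a = x \<and> b = y) + of_bool (a = y \<and> b = x)) * (2 :: real)" for a b
    using \<open>x \<noteq> y\<close> by (auto simp: indicator_def)
  have "N {x} + N {y} - N {x, y}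
    = (\<Sum>a\<in>A. \<Sum>b\<in>A. (c a b - c' a b) * ((indicator {x} a - indicator {x} b)\<^sup>2
        + (indicator {y} a - indicator {y} b)\<^sup>2 - (indicator {x, y} a - indicator {x, y} b)\<^sup>2)) / 2"
    by (simp add: N_def network_energy_def sum.distrib sum_subtractf distrib_left
        right_diff_distrib diff_divide_distrib add_divide_distrib)
  also have "\<dots> = (\<Sum>a\<in>A. \<Sum>b\<in>A. (if a = x then if b = y then c a b - c' a b else 0 else 0)
      + (if a = y then if b = x then c a b - c' a b else 0 else 0))"
    unfolding pt sum_divide_distrib by (intro sum.cong refl) (auto simp: \<open>x \<noteq> y\<close>)
  also have "\<dots> = (\<Sum>a\<in>A. if a = x then c x y - c' x y else 0) + (\<Sum>a\<in>A. if a = y then c y x - c' y x else 0)"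
    unfolding sum.distrib
    by (intro arg_cong2[where f = "(+)"] sum.cong refl) (use assms in auto)
  also have "\<dots> = 2 * (c x y - c' x y)"
    using assms by simp
  finally show ?thesis by (simp add: N0)
qed

section \<open>The gasket as a fixed point\<close>

lemma UNIV_3': "(UNIV :: 3 set) = {0, 1, 2}"
  using UNIV_3 by auto

lemma sum_3': "sum f (UNIV :: 3 set) = f 0 + f 1 + f 2"
  unfolding UNIV_3' by (simp add: ac_simps)

lemma forall_3': "(\<forall>i::3. P i) \<longleftrightarrow> P 0 \<and> P 1 \<and> P 2"
  using UNIV_3' by (metis UNIV_I insertE singletonD)

lemma F_vertex: "F q i (q i) = q i" "F q i (q j) = F q j (q i)"
  by (auto simp: F_def add.commute scaleR_2[symmetric])

lemma F_inverse: "2 *\<^sub>R F q i x - q i = x"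
  by (simp add: F_def)

lemma inj_F: "inj (F q i)"
  by (rule inj_on_inverseI[of _ "\<lambda>x. 2 *\<^sub>R x - q i"]) (simp add: F_inverse)

lemma F_eq_iff [simp]: "F q i x = F q i y \<longleftrightarrow> x = y"
  using inj_F by (auto dest: injD)

lemma continuous_on_F: "continuous_on S (F q i)"
  unfolding F_def by (intro continuous_intros)

lemma dist_F: "dist (F q i x) (F q i y) = dist x y / 2"
  by (simp add: F_def dist_norm scaleR_diff_right[symmetric] del: scaleR_diff_right)

locale gasket =
  fixes q :: "3 \<Rightarrow> real^2"
  assumes equilateral: "equilateral q"
begin

section \<open>Barycentric coordinates and the triangle\<close>

text \<open>
  If \<open>g\<close> is the centroid and \<open>s\<close> the side length, the inner product of \<open>q i - g\<close> with itself is
  \<open>s\<^sup>2 / 3\<close> and that with \<open>q j - g\<close> is \<open>- s\<^sup>2 / 6\<close>; this gives the factor \<open>2 / s\<^sup>2\<close>.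
\<close>

definition bary :: "3 \<Rightarrow> real^2 \<Rightarrow> real" where
  "bary i x = 1/3 + 2 / (dist (q 0) (q 1))\<^sup>2 *
     ((x - (1/3) *\<^sub>R (q 0 + q 1 + q 2)) \<bullet> (q i - (1/3) *\<^sub>R (q 0 + q 1 + q 2)))"

lemma bary_vertex: "bary i (q j) = of_bool (i = j)"
proof -
  define s where "s = (dist (q 0) (q 1))\<^sup>2"
  have s: "s \<noteq> 0" "dist (q 1) (q 2) ^ 2 = s" "dist (q 2) (q 0) ^ 2 = s" "dist (q 0) (q 1) ^ 2 = s"
    using equilateral by (auto simp: equilateral_def s_def)
  have e: "q 0 \<bullet> q 0 - 2 * (q 0 \<bullet> q 1) + q 1 \<bullet> q 1 = s"
    "q 1 \<bullet> q 1 - 2 * (q 1 \<bullet> q 2) + q 2 \<bullet> q 2 = s"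
    "q 0 \<bullet> q 0 - 2 * (q 0 \<bullet> q 2) + q 2 \<bullet> q 2 = s"
    using s(2-) by (simp_all add: dist_norm power2_norm_eq_inner inner_diff inner_commute)
  have "\<forall>i j. 2 * ((q j - (1/3) *\<^sub>R (q 0 + q 1 + q 2)) \<bullet> (q i - (1/3) *\<^sub>R (q 0 + q 1 + q 2)))
    = (of_bool (i = j) - 1/3) * s"
    unfolding forall_3' using e
    by (simp add: inner_diff inner_add inner_commute algebra_simps)
  then show ?thesis
    using s(1) unfolding bary_def s_def[symmetric] by (simp add: field_simps)
qed

lemma bary_F: "bary i (F q j x) = (bary i x + of_bool (i = j)) / 2"
  \<comment> \<open>With \<open>of_bool (i = j)\<close> rewritten as \<open>bary i (q j)\<close>,
    the claim is that the affine map \<open>bary i\<close> respects midpoints.\<close>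
  unfolding bary_vertex[symmetric]
  by (simp add: F_def bary_def inner_diff inner_add algebra_simps add_divide_distrib)

lemma continuous_on_bary: "continuous_on S (bary i)"
  unfolding bary_def by (intro continuous_intros)

text \<open>The convex hull of the corners. Stating the reconstruction of \<open>x\<close> from its
  coordinates as a condition avoids an argument about affine independence in the plane.\<close>

definition triangle :: "(real^2) set" where
  "triangle = {x. (\<forall>i. 0 \<le> bary i x) \<and> (\<Sum>i\<in>UNIV. bary i x) = 1 \<and> x = (\<Sum>i\<in>UNIV. bary i x *\<^sub>R q i)}"

lemma vertex_in_triangle: "q i \<in> triangle"
proof -
  have "\<forall>i. q i \<in> triangle"
    unfolding forall_3' by (simp add: triangle_def bary_vertex sum_3')
  then show ?thesis by blast
qed

lemma F_in_triangle:
  assumes "x \<in> triangle" shows "F q i x \<in> triangle"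
proof -
  have "F q i x = (\<Sum>j\<in>UNIV. bary j (F q i x) *\<^sub>R q j)"
  proof -
    have "(\<Sum>j\<in>UNIV. bary j (F q i x) *\<^sub>R q j) = (1/2) *\<^sub>R (\<Sum>j\<in>UNIV. bary j x *\<^sub>R q j + (if j = i then q j else 0))"
      unfolding scaleR_sum_right by (intro sum.cong) (auto simp: bary_F algebra_simps add_divide_distrib)
    also have "\<dots> = F q i x"
      using assms by (simp add: sum.distrib F_def triangle_def)
    finally show ?thesis by simp
  qed
  moreover have "(\<Sum>j\<in>UNIV. bary j (F q i x)) = 1"
    using assms by (simp add: bary_F sum.distrib sum_divide_distrib[symmetric] triangle_def of_bool_def)
  moreover have "0 \<le> bary j (F q i x)" for j
    using assms by (simp add: triangle_def bary_F)
  ultimately show ?thesis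
    unfolding triangle_def by blast
qed

lemma compact_triangle: "compact triangle"
proof (rule compact_eq_bounded_closed[THEN iffD2], rule conjI)
  have "norm x \<le> (\<Sum>i\<in>UNIV. norm (q i))" if "x \<in> triangle" for x
  proof -
    have le: "bary i x \<le> 1" for i
      using that member_le_sum[of i UNIV "\<lambda>i. bary i x"] by (auto simp: triangle_def)
    have "norm x = norm (\<Sum>i\<in>UNIV. bary i x *\<^sub>R q i)"
      using that by (simp add: triangle_def)
    also have "\<dots> \<le> (\<Sum>i\<in>UNIV. norm (q i))"
      using that le by (intro sum_norm_le) (auto simp: triangle_def intro!: mult_left_le_one_le)
    finally show ?thesis .
  qed
  then show "bounded triangle"
    by (meson boundedI)
  show "closed triangle"
    unfolding triangle_def
    by (intro closed_Collect_conj closed_Collect_all closed_Collect_le closed_Collect_eq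
        continuous_intros continuous_on_bary)
qed

text \<open>The coordinate \<open>bary j\<close> is at most 1/2 on cell \<open>i\<close> and at
  least 1/2 on cell \<open>j\<close>. At a common point it is 1/2, so \<open>bary j x = 1\<close>,
  which forces \<open>x\<close> to be the corner \<open>q j\<close>.\<close>

lemma F_eq_F_imp:
  assumes "x \<in> triangle" "y \<in> triangle" "F q i x = F q j y" "i \<noteq> j"
  shows "x = q j"
proof -
  have "bary j (F q i x) = bary j (F q j y)"
    using assms by simp
  moreover have "0 \<le> bary j y"
    using assms(2) by (simp add: triangle_def)
  ultimately have 1: "1 \<le> bary j x"
    using assms(4) by (simp add: bary_F)
  have sum: "bary j x + (\<Sum>k\<in>UNIV - {j}. bary k x) = 1"
    using assms(1) by (simp add: triangle_def sum.remove[of UNIV j])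
  moreover have "0 \<le> (\<Sum>k\<in>UNIV - {j}. bary k x)"
    using assms(1) by (intro sum_nonneg) (auto simp: triangle_def)
  ultimately have "bary j x = 1" and "(\<Sum>k\<in>UNIV - {j}. bary k x) = 0"
    using 1 by auto
  moreover from this have "bary k x = 0" if "k \<noteq> j" for k
    using assms(1) that by (simp add: sum_nonneg_eq_0_iff triangle_def)
  ultimately have "(\<Sum>i\<in>UNIV. bary i x *\<^sub>R q i) = (\<Sum>i\<in>UNIV. if i = j then q i else 0)"
    by (intro sum.cong) auto
  then show ?thesis
    using assms(1) by (simp add: triangle_def)
qed

section \<open>Existence and uniqueness of the invariant compact set\<close>

definition hutchinson :: "(real^2) set \<Rightarrow> (real^2) set" where
  "hutchinson K = (\<Union>i. F q i ` K)"

text \<open>Take a point of \<open>K\<close> farthest from \<open>L\<close>. It is the image of a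
  point of \<open>K\<close> under a map that halves distances and preserves \<open>L\<close>, so the
  maximal distance is at most half of itself, hence zero.\<close>

lemma hutchinson_fixed_point_subset:
  assumes K: "compact K" "K = hutchinson K" and L: "L \<noteq> {}" "compact L" "L = hutchinson L"
  shows "K \<subseteq> L"
proof (cases "K = {}")
  case False
  obtain x where x: "x \<in> K" "\<And>z. z \<in> K \<Longrightarrow> infdist z L \<le> infdist x L"
    using continuous_attains_sup[OF K(1) False continuous_on_infdist[OF continuous_on_id], of L]
    by blast
  have "x \<in> hutchinson K"
    using x(1) K(2) by blast
  then obtain i y where y: "y \<in> K" "x = F q i y"
    by (auto simp: hutchinson_def)
  obtain z where z: "z \<in> L" "infdist y L = dist y z"
    using infdist_attains_inf[OF compact_imp_closed[OF L(2)] L(1)] by blast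
  have "F q i z \<in> hutchinson L"
    using z(1) by (auto simp: hutchinson_def)
  then have "F q i z \<in> L"
    using L(3) by blast
  then have "infdist x L \<le> infdist y L / 2"
    using infdist_le[of "F q i z" L x] z(2) y(2) by (simp add: dist_F)
  then have "infdist x L \<le> 0"
    using x(2)[OF y(1)] by simp
  then have "infdist u L = 0" if "u \<in> K" for u
    using x(2)[OF that] infdist_nonneg[of u L] by linarith
  then show ?thesis
    using in_closed_iff_infdist_zero[OF compact_imp_closed[OF L(2)] L(1)] by blast
qed simp

lemma hutchinson_mono: "K \<subseteq> L \<Longrightarrow> hutchinson K \<subseteq> hutchinson L"
  unfolding hutchinson_def by blast

text \<open>The invariant set is the intersection of the decreasing iterated images of the triangle.
  Starting from the triangle also yields the corners as elements and the triangle as an upper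
  bound.\<close>

lemma hutchinson_fixed_point_exists:
  "\<exists>K. range q \<subseteq> K \<and> compact K \<and> K = hutchinson K \<and> K \<subseteq> triangle"
proof -
  define T where "T n = (hutchinson ^^ n) triangle" for n
  have T_Suc: "T (Suc n) = hutchinson (T n)" for n
    by (simp add: T_def)
  have compact: "compact (T n)" for n
    by (induction n) (auto simp: T_def compact_triangle hutchinson_def
        intro!: compact_UN compact_continuous_image continuous_on_F)
  have step: "T (Suc n) \<subseteq> T n" for n
  proof (induction n)
    case 0
    then show ?case
      by (auto simp: T_def hutchinson_def F_in_triangle)
  next
    case (Suc n)
    then show ?case
      using hutchinson_mono by (simp add: T_Suc)
  qed
  then have anti: "m \<le> n \<Longrightarrow> T n \<subseteq> T m" for m n
    using lift_Suc_antimono_le[of T] by blast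
  have vertex: "q i \<in> T n" for i n
  proof (induction n)
    case 0
    then show ?case by (simp add: T_def vertex_in_triangle)
  next
    case (Suc n)
    then have "F q i (q i) \<in> T (Suc n)"
      unfolding T_Suc hutchinson_def by blast
    then show ?case by (simp add: F_vertex)
  qed
  define K where "K = (\<Inter>n. T n)"
  have "K = hutchinson K"
  proof
    show "hutchinson K \<subseteq> K"
    proof
      fix x assume "x \<in> hutchinson K"
      then have "x \<in> T (Suc n)" for n
        unfolding T_Suc using hutchinson_mono[of K "T n"] by (auto simp: K_def)
      then show "x \<in> K"
        using step by (auto simp: K_def)
    qed
    show "K \<subseteq> hutchinson K"
    proof
      fix x assume "x \<in> K"
      then have "x \<in> hutchinson (T n)" for n
        unfolding T_Suc[symmetric] K_def by blast
      then have "\<exists>i. x \<in> F q i ` T n" for n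
        by (auto simp: hutchinson_def)
      then obtain f where f: "\<And>n. x \<in> F q (f n) ` T n"
        by metis
      \<comment> \<open>One index serves infinitely many levels, hence all levels, as the
        \<open>T n\<close> decrease; the preimage of \<open>x\<close> under that one injective map
        then lies in every \<open>T n\<close>.\<close>
      obtain i where "infinite {n. f n = i}"
        using pigeonhole_infinite[of UNIV f] by auto
      then have "\<exists>m\<ge>n. f m = i" for n
        by (auto simp: infinite_nat_iff_unbounded_le)
      then have "x \<in> F q i ` T n" for n
        using f anti by (metis image_mono subsetD)
      then have "2 *\<^sub>R x - q i \<in> K"
        unfolding K_def using F_inverse[of q i] by (metis INT_I imageE)
      moreover have "x = F q i (2 *\<^sub>R x - q i)"
        by (simp add: F_def)
      ultimately show "x \<in> hutchinson K"
        unfolding hutchinson_def by blast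
    qed
  qed
  moreover have "compact K"
    unfolding K_def using compact by (intro compact_Inter) auto
  moreover have "range q \<subseteq> K"
    using vertex by (auto simp: K_def)
  moreover have "K \<subseteq> triangle"
  proof
    fix x assume "x \<in> K"
    then have "x \<in> T 0" by (simp add: K_def)
    then show "x \<in> triangle" by (simp add: T_def)
  qed
  ultimately show ?thesis by blast
qed

lemma SG_compact: "compact (SG q)"
  and SG_fixed_point: "SG q = (\<Union>i. F q i ` SG q)"
  and SG_subset_triangle: "SG q \<subseteq> triangle"
  and vertex_in_SG: "q i \<in> SG q"
proof -
  obtain K where K: "range q \<subseteq> K" "compact K" "K = hutchinson K" "K \<subseteq> triangle"
    using hutchinson_fixed_point_exists by blast
  have "SG q = K"
    unfolding SG_def hutchinson_def[symmetric]
  proof (rule the_equality)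
    show "K \<noteq> {} \<and> compact K \<and> K = hutchinson K"
      using K by blast
    show "L = K" if "L \<noteq> {} \<and> compact L \<and> L = hutchinson L" for L
      using that K hutchinson_fixed_point_subset[of L K] hutchinson_fixed_point_subset[of K L] by blast
  qed
  then show "compact (SG q)" "SG q = (\<Union>i. F q i ` SG q)" "SG q \<subseteq> triangle" "q i \<in> SG q"
    using K unfolding hutchinson_def by blast+
qed

lemma F_in_SG: "x \<in> SG q \<Longrightarrow> F q i x \<in> SG q"
  using SG_fixed_point by blast

text \<open>Finite ramification: two different cells of level 1 can share only the midpoint
  \<open>F q i (q j) = F q j (q i)\<close>. Gluing and the splitting of edge sets rest on
  this.\<close>

lemma SG_F_eq_F_imp:
  assumes "x \<in> SG q" "y \<in> SG q" "F q i x = F q j y" "i \<noteq> j"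
  shows "x = q j" "y = q i"
  using F_eq_F_imp assms SG_subset_triangle by (blast, metis F_eq_F_imp subsetD)

section \<open>Self-similarity of the energy\<close>

lemma finite_V: "finite (V q m)"
  by (induction m) auto

lemma V_0: "V q 0 = range q"
  by (simp add: UNIV_3')

lemma V_subset_SG: "V q m \<subseteq> SG q"
proof (induction m)
  case 0
  then show ?case using vertex_in_SG by (simp del: V.simps add: V_0 image_subset_iff)
next
  case (Suc m)
  then show ?case using F_in_SG by auto
qed

lemma Fword_V: "length w = m \<Longrightarrow> x \<in> V q 0 \<Longrightarrow> Fword q w x \<in> V q m"
proof (induction w arbitrary: m)
  case (Cons i w)
  then show ?case by (cases m) auto
qed auto

lemma adj_in_V: "adj q m x y \<Longrightarrow> x \<in> V q m \<and> y \<in> V q m"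
  unfolding adj_def using Fword_V by blast

lemma adj_commute: "adj q m x y \<longleftrightarrow> adj q m y x"
  unfolding adj_def by blast

lemma adj_0: "adj q 0 x y \<longleftrightarrow> x \<noteq> y \<and> x \<in> range q \<and> y \<in> range q"
  unfolding adj_def V_0 by simp

lemma adj_Suc: "adj q (Suc m) x y \<longleftrightarrow> (\<exists>i x' y'. x = F q i x' \<and> y = F q i y' \<and> adj q m x' y')"
proof -
  \<comment> \<open>Injectivity of \<open>F q i\<close> transfers the distinctness of the endpoints
    to their preimages in the cell.\<close>
  have image: "x \<noteq> y \<and> (\<exists>i w. P w \<and> x \<in> F q i ` S w \<and> y \<in> F q i ` S w)
      \<longleftrightarrow> (\<exists>i x' y'. x = F q i x' \<and> y = F q i y' \<and> x' \<noteq> y' \<and> (\<exists>w. P w \<and> x' \<in> S w \<and> y' \<in> S w))"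
    for P :: "3 list \<Rightarrow> bool" and S
    by (simp add: image_iff) (metis F_eq_iff)
  have "adj q (Suc m) x y \<longleftrightarrow> x \<noteq> y \<and> (\<exists>i w. length w = m
      \<and> x \<in> F q i ` (Fword q w ` V q 0) \<and> y \<in> F q i ` (Fword q w ` V q 0))"
    unfolding adj_def length_Suc_conv image_comp Fword.simps(2)[symmetric] by blast
  then show ?thesis
    unfolding image unfolding adj_def .
qed

lemma finite_adj: "finite {(x, y). adj q m x y}"
  by (rule finite_subset[of _ "V q m \<times> V q m"]) (use adj_in_V finite_V in auto)

lemma graph_energy_0:
  "graph_energy q 0 u = (u (q 0) - u (q 1))\<^sup>2 + (u (q 1) - u (q 2))\<^sup>2 + (u (q 0) - u (q 2))\<^sup>2"
proof -
  have ne: "q 0 \<noteq> q 1" "q 1 \<noteq> q 2" "q 0 \<noteq> q 2"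
    using equilateral by (auto simp: equilateral_def)
  have "{(x, y). adj q 0 x y} = {(q 0, q 1), (q 1, q 0), (q 1, q 2), (q 2, q 1), (q 0, q 2), (q 2, q 0)}"
    using ne by (auto simp: adj_0 UNIV_3')
  then show ?thesis
    using ne by (simp add: graph_energy_def power2_commute[of "u (q 1)" "u (q 0)"]
        power2_commute[of "u (q 2)" "u (q 0)"] power2_commute[of "u (q 2)" "u (q 1)"])
qed

text \<open>The edges of level \<open>Suc m\<close> are three copies of those of level
  \<open>m\<close>. The copies are disjoint, because both endpoints of a shared edge would be the
  single point common to two cells.\<close>

lemma graph_energy_Suc:
  "graph_energy q (Suc m) u = 5/3 * (\<Sum>i\<in>UNIV. graph_energy q m (u \<circ> F q i))"
proof -
  define f where "f i = map_prod (F q i) (F q i)" for i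
  let ?P = "\<lambda>m. {(x, y). adj q m x y}"
  have eq: "?P (Suc m) = (\<Union>i. f i ` ?P m)"
    unfolding f_def by (auto simp: adj_Suc image_iff)
  have disj: "f i ` ?P m \<inter> f j ` ?P m = {}" if "i \<noteq> j" for i j
  proof (rule ccontr)
    assume "f i ` ?P m \<inter> f j ` ?P m \<noteq> {}"
    then obtain x y x' y' where xy: "F q i x = F q j x'" "F q i y = F q j y'"
      "adj q m x y" "adj q m x' y'"
      by (auto simp: f_def)
    then have "x \<in> SG q" "y \<in> SG q" "x' \<in> SG q" "y' \<in> SG q"
      using adj_in_V V_subset_SG by blast+
    then have "x = y"
      using SG_F_eq_F_imp(1) xy that by metis
    then show False
      using xy(3) by (simp add: adj_def)
  qed
  have inj: "inj_on (f i) S" for i S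
    unfolding f_def using inj_F by (intro inj_on_subset[OF prod.inj_map]) auto
  have "(\<Sum>(x, y)\<in>?P (Suc m). (u x - u y)\<^sup>2)
      = (\<Sum>i\<in>UNIV. \<Sum>(x, y)\<in>f i ` ?P m. (u x - u y)\<^sup>2)"
    unfolding eq using finite_adj disj by (intro sum.UNION_disjoint) auto
  also have "\<dots> = (\<Sum>i\<in>UNIV. \<Sum>(x, y)\<in>?P m. (u (F q i x) - u (F q i y))\<^sup>2)"
    unfolding sum.reindex[OF inj] by (simp add: f_def case_prod_beta)
  finally show ?thesis
    by (simp add: graph_energy_def sum_distrib_left[symmetric] sum_divide_distrib[symmetric])
qed

lemma graph_energy_nonneg: "0 \<le> graph_energy q m u"
  unfolding graph_energy_def by (auto intro!: mult_nonneg_nonneg divide_nonneg_nonneg sum_nonneg)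

lemma graph_energy_cong:
  assumes "\<And>x. x \<in> V q m \<Longrightarrow> u x = v x"
  shows "graph_energy q m u = graph_energy q m v"
proof -
  have "(\<Sum>(x, y)\<in>{(x, y). adj q m x y}. (u x - u y)\<^sup>2) = (\<Sum>(x, y)\<in>{(x, y). adj q m x y}. (v x - v y)\<^sup>2)"
    using assms adj_in_V by (intro sum.cong) auto
  then show ?thesis by (simp add: graph_energy_def)
qed

text \<open>
  For fixed corner values, the renormalized energy of level 1 is minimized by the midpoint values
  of the 1/5-2/5 rule; the difference is a sum of squares of the deviations from them.
\<close>

lemma graph_energy_0_le_1: "graph_energy q 0 u \<le> graph_energy q (Suc 0) u"
proof -
  have key: "(a - b)\<^sup>2 + (b - c)\<^sup>2 + (a - c)\<^sup>2 \<le> 5/3 *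
      (((a - x)\<^sup>2 + (x - y)\<^sup>2 + (a - y)\<^sup>2) + ((x - b)\<^sup>2 + (b - z)\<^sup>2 + (x - z)\<^sup>2)
        + ((y - z)\<^sup>2 + (z - c)\<^sup>2 + (y - c)\<^sup>2))"
    for a b c x y z :: real
  proof -
    define X where "X = x - (2 * a + 2 * b + c) / 5"
    define Y where "Y = y - (2 * a + 2 * c + b) / 5"
    define Z where "Z = z - (2 * b + 2 * c + a) / 5"
    have "5/3 * (((a - x)\<^sup>2 + (x - y)\<^sup>2 + (a - y)\<^sup>2) + ((x - b)\<^sup>2 + (b - z)\<^sup>2 + (x - z)\<^sup>2)
        + ((y - z)\<^sup>2 + (z - c)\<^sup>2 + (y - c)\<^sup>2))
      = (a - b)\<^sup>2 + (b - c)\<^sup>2 + (a - c)\<^sup>2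
        + 5/3 * (2 * X\<^sup>2 + 2 * Y\<^sup>2 + 2 * Z\<^sup>2 + (X - Y)\<^sup>2 + (Y - Z)\<^sup>2 + (X - Z)\<^sup>2)"
      unfolding X_def Y_def Z_def by (simp add: field_simps power2_eq_square)
    then show ?thesis by simp
  qed
  show ?thesis
    using key[of "u (q 0)" "u (q 1)" "u (q 2)" "u (F q 0 (q 1))" "u (F q 0 (q 2))" "u (F q 1 (q 2))"]
    by (simp add: graph_energy_Suc graph_energy_0 sum_3' F_vertex(1)
        F_vertex(2)[of q 1 0] F_vertex(2)[of q 2 0] F_vertex(2)[of q 2 1])
qed

lemma graph_energy_le_Suc: "graph_energy q m u \<le> graph_energy q (Suc m) u"
proof (induction m arbitrary: u)
  case 0
  show ?case by (rule graph_energy_0_le_1)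
next
  case (Suc m)
  show ?case
    unfolding graph_energy_Suc[of "Suc m" u] graph_energy_Suc[of m u]
    by (rule mult_left_mono[OF sum_mono]) (simp_all add: Suc)
qed

lemma graph_energy_mono: "m \<le> n \<Longrightarrow> graph_energy q m u \<le> graph_energy q n u"
  by (rule lift_Suc_mono_le[of "\<lambda>m. graph_energy q m u", OF graph_energy_le_Suc])

text \<open>By monotonicity the limit defining \<open>energy\<close> always exists in
  \<open>ereal\<close> and is a supremum, infinite values included.\<close>

lemma graph_energy_tendsto: "(\<lambda>m. ereal (graph_energy q m u)) \<longlonglongrightarrow> energy q u"
  and energy_eq_SUP: "energy q u = (SUP m. ereal (graph_energy q m u))"
proof -
  have "(\<lambda>m. ereal (graph_energy q m u)) \<longlonglongrightarrow> (SUP m. ereal (graph_energy q m u))"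
    by (intro LIMSEQ_SUP) (simp add: incseq_def graph_energy_mono)
  moreover from this show "energy q u = (SUP m. ereal (graph_energy q m u))"
    unfolding energy_def by (intro limI)
  ultimately show "(\<lambda>m. ereal (graph_energy q m u)) \<longlonglongrightarrow> energy q u" by simp
qed

lemma graph_energy_le_energy: "ereal (graph_energy q m u) \<le> energy q u"
  unfolding energy_eq_SUP by (rule SUP_upper) simp

lemma energy_nonneg: "0 \<le> energy q u"
  by (rule order_trans[OF _ graph_energy_le_energy[of 0 u]]) (simp add: graph_energy_nonneg)

lemma energy_cong:
  assumes "\<And>x. x \<in> SG q \<Longrightarrow> u x = v x"
  shows "energy q u = energy q v"
  unfolding energy_def using assms V_subset_SG
  by (auto intro!: arg_cong[where f = lim] graph_energy_cong)

lemma energy_eq_graph_energy: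
  assumes "\<And>n. n \<ge> m \<Longrightarrow> graph_energy q n u = graph_energy q m u"
  shows "energy q u = ereal (graph_energy q m u)"
  unfolding energy_def
  by (rule limI, rule tendsto_eventually, rule eventually_sequentiallyI[of m])
    (rule arg_cong[where f = ereal, OF assms])

lemma energy_self_similar: "energy q u = ereal (5/3) * (\<Sum>i\<in>UNIV. energy q (u \<circ> F q i))"
proof (rule LIMSEQ_unique[OF graph_energy_tendsto[THEN LIMSEQ_Suc]])
  \<comment> \<open>Excluding minus infinity makes addition in \<open>ereal\<close> continuous at
    these limits.\<close>
  have "energy q v \<noteq> -\<infinity>" for v
    using energy_nonneg[of v] by auto
  then have "(\<lambda>m. ereal (5/3) * (\<Sum>i\<in>UNIV. ereal (graph_energy q m (u \<circ> F q i))))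
    \<longlonglongrightarrow> ereal (5/3) * (\<Sum>i\<in>UNIV. energy q (u \<circ> F q i))"
    unfolding sum_3'
    by (intro tendsto_cmult_ereal tendsto_add_ereal_nonneg graph_energy_tendsto) auto
  then show "(\<lambda>m. ereal (graph_energy q (Suc m) u))
    \<longlonglongrightarrow> ereal (5/3) * (\<Sum>i\<in>UNIV. energy q (u \<circ> F q i))"
    by (simp add: graph_energy_Suc)
qed

lemma energy_finite_iff: "energy q u < \<infinity> \<longleftrightarrow> (\<forall>i. energy q (u \<circ> F q i) < \<infinity>)"
proof -
  have "energy q v \<noteq> -\<infinity>" for v
    using energy_nonneg[of v] by auto
  then show ?thesis
    unfolding energy_self_similar[of u] sum_3' forall_3'
    by (cases "energy q (u \<circ> F q 0)"; cases "energy q (u \<circ> F q 1)"; cases "energy q (u \<circ> F q 2)") auto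
qed

text \<open>Pasting: the gasket is a finite union of closed cells, and on cell \<open>i\<close> the
  function \<open>u\<close> is \<open>u \<circ> F q i\<close> after the inverse map.\<close>

lemma continuous_on_SG_iff:
  "continuous_on (SG q) u \<longleftrightarrow> (\<forall>i. continuous_on (SG q) (u \<circ> F q i))"
proof
  assume "continuous_on (SG q) u"
  then show "\<forall>i. continuous_on (SG q) (u \<circ> F q i)"
    using F_in_SG by (intro allI continuous_on_compose continuous_on_F)
      (auto elim: continuous_on_subset)
next
  assume cont: "\<forall>i. continuous_on (SG q) (u \<circ> F q i)"
  have "continuous_on (F q i ` SG q) u" for i
  proof -
    have "continuous_on (F q i ` SG q) (\<lambda>x. (u \<circ> F q i) (2 *\<^sub>R x - q i))"
      by (rule continuous_on_compose2[OF cont[rule_format, of i]])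
        (auto simp: F_inverse intro!: continuous_intros)
    then show ?thesis
      by (simp add: F_def)
  qed
  moreover have "closed (F q i ` SG q)" for i
    by (intro compact_imp_closed compact_continuous_image continuous_on_F SG_compact)
  ultimately have "continuous_on (\<Union>i. F q i ` SG q) u"
    by (intro continuous_on_closed_Union) auto
  then show "continuous_on (SG q) u"
    using SG_fixed_point by simp
qed

lemma dom_energy_iff: "u \<in> dom_energy q \<longleftrightarrow> (\<forall>i. u \<circ> F q i \<in> dom_energy q)"
  unfolding dom_energy_def mem_Collect_eq continuous_on_SG_iff[of u] energy_finite_iff[of u] by blast

lemma dom_energy_cong:
  assumes "\<And>x. x \<in> SG q \<Longrightarrow> u x = v x"
  shows "u \<in> dom_energy q \<longleftrightarrow> v \<in> dom_energy q"
proof -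
  have "energy q u = energy q v" "continuous_on (SG q) u \<longleftrightarrow> continuous_on (SG q) v"
    using assms by (intro energy_cong continuous_on_cong; simp)+
  then show ?thesis
    by (simp add: dom_energy_def)
qed

text \<open>Any cell containing \<open>x\<close> may be chosen, and
  \<open>2 *\<^sub>R x - q i\<close> is the preimage of \<open>x\<close> in it;
  \<open>glue_F\<close> shows independence of the choice when the corner values match.\<close>

definition glue :: "(3 \<Rightarrow> real^2 \<Rightarrow> real) \<Rightarrow> real^2 \<Rightarrow> real" where
  "glue g x = (let i = SOME i. x \<in> F q i ` SG q in g i (2 *\<^sub>R x - q i))"

text \<open>The chosen cell can differ from \<open>i\<close> only at a midpoint shared by two cells,
  and \<open>compat\<close> says that the two pieces agree there.\<close>

lemma glue_F:
  assumes compat: "\<And>i j. g i (q j) = g j (q i)" and "x \<in> SG q"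
  shows "glue g (F q i x) = g i x"
proof -
  define j where "j = (SOME j. F q i x \<in> F q j ` SG q)"
  have "F q i x \<in> F q j ` SG q"
    unfolding j_def by (rule someI[of _ i]) (use assms(2) in blast)
  then obtain y where y: "y \<in> SG q" "F q i x = F q j y"
    by blast
  have "glue g (F q i x) = g j (2 *\<^sub>R F q i x - q j)"
    by (simp only: glue_def Let_def j_def)
  also have "\<dots> = g j y"
    unfolding y(2) F_inverse ..
  also have "\<dots> = g i x"
    using SG_F_eq_F_imp[OF assms(2) y] y(2) compat by (cases "i = j") auto
  finally show ?thesis .
qed

section \<open>Harmonic functions\<close>

lemma glue_in_dom_energy:
  assumes compat: "\<And>i j. g i (q j) = g j (q i)" and "\<And>i. g i \<in> dom_energy q"
  shows "glue g \<in> dom_energy q"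
proof -
  have "glue g \<circ> F q i \<in> dom_energy q \<longleftrightarrow> g i \<in> dom_energy q" for i
    by (rule dom_energy_cong) (simp add: glue_F[of g, OF compat])
  then show ?thesis
    using assms(2) dom_energy_iff by blast
qed

lemma energy_glue:
  assumes compat: "\<And>i j. g i (q j) = g j (q i)"
  shows "energy q (glue g) = ereal (5/3) * (\<Sum>i\<in>UNIV. energy q (g i))"
proof -
  have "energy q (glue g \<circ> F q i) = energy q (g i)" for i
    by (rule energy_cong) (simp add: glue_F[of g, OF compat])
  then show ?thesis
    by (simp only: energy_self_similar[of "glue g"])
qed

text \<open>
  The 1/5-2/5 rule: the corner values on cell \<open>i\<close> of the harmonic function with corner values \<open>a\<close>.
\<close>

definition harmonic_rule :: "3 \<Rightarrow> (3 \<Rightarrow> real) \<Rightarrow> 3 \<Rightarrow> real" where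
  "harmonic_rule i a j = (if i = j then a i else (a i + a j + (\<Sum>k\<in>UNIV. a k)) / 5)"

lemma harmonic_rule_commute: "harmonic_rule i a j = harmonic_rule j a i"
  by (simp add: harmonic_rule_def)

text \<open>For \<open>i \<noteq> j\<close> the value is an average of the corner values with
  weights 2/5, 2/5 and 1/5.\<close>

lemma harmonic_rule_between:
  assumes "\<And>i. l \<le> a i \<and> a i \<le> r"
  shows "l \<le> harmonic_rule i a j \<and> harmonic_rule i a j \<le> r"
  using assms[of 0] assms[of 1] assms[of 2] assms[of i] assms[of j]
  by (simp add: harmonic_rule_def sum_3')

text \<open>With \<open>l\<close> the third index, the difference from corner \<open>k\<close> to
  \<open>j\<close> is \<open>(2 * (a k - a j) + (a k - a l)) / 5\<close>; between the two other
  corners it is a fifth of the old difference. This gives geometric convergence of the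
  approximations.\<close>

lemma harmonic_rule_contraction:
  assumes "\<And>i j. \<bar>a i - a j\<bar> \<le> d"
  shows "\<bar>harmonic_rule k a i - harmonic_rule k a j\<bar> \<le> 3/5 * d"
proof -
  have "\<forall>k i j. \<bar>harmonic_rule k a i - harmonic_rule k a j\<bar> \<le> 3/5 * d"
    unfolding forall_3' using assms[of 0 1] assms[of 1 2] assms[of 0 2]
    by (auto simp: harmonic_rule_def sum_3' abs_le_iff field_simps)
  then show ?thesis by blast
qed

text \<open>The rule is applied down to the cells of level \<open>n\<close>, and inside these the
  corner values are interpolated affinely.\<close>

primrec harmonic_approx :: "nat \<Rightarrow> (3 \<Rightarrow> real) \<Rightarrow> real^2 \<Rightarrow> real" where
  "harmonic_approx 0 a = (\<lambda>x. \<Sum>i\<in>UNIV. a i * bary i x)"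
| "harmonic_approx (Suc n) a = glue (\<lambda>i. harmonic_approx n (harmonic_rule i a))"

text \<open>Together with \<open>harmonic_rule_commute\<close> this is the compatibility condition
  needed to evaluate the glued function.\<close>

lemma harmonic_approx_vertex: "harmonic_approx n a (q j) = a j"
proof (induction n arbitrary: a j)
  case 0
  have "(\<Sum>i\<in>UNIV. a i * bary i (q j)) = (\<Sum>i\<in>UNIV. if i = j then a i else 0)"
    by (intro sum.cong) (auto simp: bary_vertex)
  then show ?case by simp
next
  case (Suc n)
  have "harmonic_approx (Suc n) a (F q j (q j)) = harmonic_rule j a j"
    by (simp add: glue_F vertex_in_SG Suc harmonic_rule_commute)
  then show ?case
    by (simp add: F_vertex(1) harmonic_rule_def del: harmonic_approx.simps)
qed

lemma harmonic_approx_F: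
  assumes "x \<in> SG q"
  shows "harmonic_approx (Suc n) a (F q i x) = harmonic_approx n (harmonic_rule i a) x"
  using assms by (simp add: glue_F harmonic_approx_vertex harmonic_rule_commute)

lemma SG_cases:
  assumes "x \<in> SG q" obtains i y where "y \<in> SG q" "x = F q i y"
  using assms SG_fixed_point by blast

lemma continuous_on_harmonic_approx: "continuous_on (SG q) (harmonic_approx n a)"
proof (induction n arbitrary: a)
  case 0
  show ?case
    by (auto intro!: continuous_intros continuous_on_bary)
next
  case (Suc n)
  have "continuous_on (SG q) (harmonic_approx (Suc n) a \<circ> F q i)
      \<longleftrightarrow> continuous_on (SG q) (harmonic_approx n (harmonic_rule i a))" for i
    by (intro continuous_on_cong) (simp_all add: harmonic_approx_F del: harmonic_approx.simps)
  then show ?case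
    using Suc continuous_on_SG_iff by blast
qed

lemma harmonic_approx_between:
  assumes "x \<in> SG q" "\<And>i. l \<le> a i \<and> a i \<le> r"
  shows "l \<le> harmonic_approx n a x \<and> harmonic_approx n a x \<le> r"
  using assms
proof (induction n arbitrary: a x)
  case 0
  have bary: "0 \<le> bary i x" "(\<Sum>i\<in>UNIV. bary i x) = 1" for i
    using 0 SG_subset_triangle by (auto simp: triangle_def)
  have "l = (\<Sum>i\<in>UNIV. l * bary i x)" "r = (\<Sum>i\<in>UNIV. r * bary i x)"
    by (simp_all add: bary(2) sum_distrib_left[symmetric])
  moreover have "(\<Sum>i\<in>UNIV. l * bary i x) \<le> harmonic_approx 0 a x"
    "harmonic_approx 0 a x \<le> (\<Sum>i\<in>UNIV. r * bary i x)"
    using 0 bary by (auto intro!: sum_mono mult_right_mono)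
  ultimately show ?case by linarith
next
  case (Suc n)
  obtain i y where y: "y \<in> SG q" "x = F q i y"
    using SG_cases[OF Suc.prems(1)] .
  show ?case
    unfolding y(2) harmonic_approx_F[OF y(1)]
    by (rule Suc.IH[OF y(1) harmonic_rule_between[OF Suc.prems(2)]])
qed

text \<open>At the top level both approximations lie between the least and the greatest corner
  value, so they differ by at most \<open>d\<close>; each descent into a cell shrinks the
  oscillation by 3/5.\<close>

lemma harmonic_approx_step:
  assumes "x \<in> SG q" "\<And>i j. \<bar>a i - a j\<bar> \<le> d"
  shows "\<bar>harmonic_approx (Suc n) a x - harmonic_approx n a x\<bar> \<le> (3/5) ^ n * d"
  using assms
proof (induction n arbitrary: a d x)
  case 0
  define l where "l = Min (range a)"
  define r where "r = Max (range a)"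
  have between: "l \<le> a i \<and> a i \<le> r" for i
    by (simp add: l_def r_def)
  have "l \<in> range a" "r \<in> range a"
    unfolding l_def r_def by (auto intro!: Min_in Max_in simp del: Min_in Max_in)
  then have "r - l \<le> d"
    using 0(2) by (metis abs_le_D1 rangeE)
  then show ?case
    using harmonic_approx_between[of x l a r 0, OF 0(1) between]
      harmonic_approx_between[of x l a r "Suc 0", OF 0(1) between]
    by (auto simp del: harmonic_approx.simps simp: abs_le_iff)
next
  case (Suc n)
  obtain i y where y: "y \<in> SG q" "x = F q i y"
    using SG_cases[OF Suc.prems(1)] .
  have "\<bar>harmonic_approx (Suc n) (harmonic_rule i a) y - harmonic_approx n (harmonic_rule i a) y\<bar>
      \<le> (3/5) ^ n * (3/5 * d)"
    by (rule Suc.IH[OF y(1) harmonic_rule_contraction[OF Suc.prems(2)]])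
  then show ?case
    unfolding y(2) harmonic_approx_F[OF y(1)] by simp
qed

definition harmonic :: "(3 \<Rightarrow> real) \<Rightarrow> real^2 \<Rightarrow> real" where
  "harmonic a x = lim (\<lambda>n. harmonic_approx n a x)"

text \<open>The approximations telescope into a series dominated by a geometric one, so they
  converge uniformly on the gasket.\<close>

lemma continuous_on_harmonic: "continuous_on (SG q) (harmonic a)"
  and harmonic_approx_tendsto:
    "x \<in> SG q \<Longrightarrow> (\<lambda>n. harmonic_approx n a x) \<longlonglongrightarrow> harmonic a x"
proof -
  define d where "d = Max (range (\<lambda>(i, j). \<bar>a i - a j\<bar>))"
  have "\<bar>a i - a j\<bar> \<in> range (\<lambda>(i, j). \<bar>a i - a j\<bar>)" for i j
    by (rule range_eqI[of _ _ "(i, j)"]) simp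
  then have d: "\<bar>a i - a j\<bar> \<le> d" for i j
    unfolding d_def by (intro Max_ge) auto
  define D where "D n x = harmonic_approx (Suc n) a x - harmonic_approx n a x" for n x
  have bound: "norm (D n x) \<le> (3/5) ^ n * d" if "x \<in> SG q" for n x
    using harmonic_approx_step[OF that d] by (simp add: D_def del: harmonic_approx.simps)
  have telescope: "harmonic_approx n a x = harmonic_approx 0 a x + (\<Sum>k<n. D k x)" for n x
    unfolding D_def by (subst sum_lessThan_telescope) simp
  have "uniform_limit (SG q) (\<lambda>n x. \<Sum>k<n. D k x) (\<lambda>x. \<Sum>k. D k x) sequentially"
    by (rule Weierstrass_m_test[OF bound]) (auto intro!: summable_mult2 summable_geometric)
  then have "uniform_limit (SG q) (\<lambda>n x. harmonic_approx 0 a x + (\<Sum>k<n. D k x))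
      (\<lambda>x. harmonic_approx 0 a x + (\<Sum>k. D k x)) sequentially"
    by (intro uniform_limit_add uniform_limit_const)
  then have lim: "uniform_limit (SG q) (\<lambda>n. harmonic_approx n a)
      (\<lambda>x. harmonic_approx 0 a x + (\<Sum>k. D k x)) sequentially"
    by (simp only: telescope[symmetric])
  have eq: "harmonic a x = harmonic_approx 0 a x + (\<Sum>k. D k x)" if "x \<in> SG q" for x
    unfolding harmonic_def by (rule limI[OF tendsto_uniform_limitI[OF lim that]])
  show "(\<lambda>n. harmonic_approx n a x) \<longlonglongrightarrow> harmonic a x" if "x \<in> SG q"
    unfolding eq[OF that] by (rule tendsto_uniform_limitI[OF lim that])
  have "continuous_on (SG q) (\<lambda>x. harmonic_approx 0 a x + (\<Sum>k. D k x))"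
    by (rule uniform_limit_theorem[OF _ lim])
      (auto intro!: always_eventually continuous_on_harmonic_approx simp del: harmonic_approx.simps)
  then show "continuous_on (SG q) (harmonic a)"
    using eq by (simp cong: continuous_on_cong del: harmonic_approx.simps)
qed

lemma harmonic_vertex: "harmonic a (q j) = a j"
  by (simp add: harmonic_def harmonic_approx_vertex)

lemma harmonic_F:
  assumes "x \<in> SG q" shows "harmonic a (F q i x) = harmonic (harmonic_rule i a) x"
proof (rule LIMSEQ_unique)
  show "(\<lambda>n. harmonic_approx (Suc n) a (F q i x)) \<longlonglongrightarrow> harmonic a (F q i x)"
    by (intro LIMSEQ_Suc harmonic_approx_tendsto F_in_SG assms)
  show "(\<lambda>n. harmonic_approx (Suc n) a (F q i x)) \<longlonglongrightarrow> harmonic (harmonic_rule i a) x"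
    unfolding harmonic_approx_F[OF assms] by (intro harmonic_approx_tendsto assms)
qed

text \<open>The rule gives equality in \<open>graph_energy_0_le_1\<close>, and self-similarity
  carries this to all levels.\<close>

lemma graph_energy_harmonic: "graph_energy q n (harmonic a) = graph_energy q 0 (harmonic a)"
proof (induction n arbitrary: a)
  case (Suc n)
  have "graph_energy q n (harmonic a \<circ> F q i) = graph_energy q n (harmonic (harmonic_rule i a))" for i
    using V_subset_SG by (intro graph_energy_cong) (auto intro: harmonic_F)
  then have "graph_energy q (Suc n) (harmonic a)
      = 5/3 * (\<Sum>i\<in>UNIV. graph_energy q 0 (harmonic (harmonic_rule i a)))"
    by (simp only: graph_energy_Suc Suc)
  \<comment> \<open>A quadratic identity in the three corner values; the factor 5/3 is what makes it
    hold.\<close>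
  also have "\<dots> = graph_energy q 0 (harmonic a)"
    unfolding graph_energy_0 harmonic_vertex sum_3'
    by (simp add: harmonic_rule_def sum_3' power2_eq_square field_simps)
  finally show ?case .
qed simp

lemma vertex_in_V: "q i \<in> V q m"
proof (induction m)
  case 0
  then show ?case by (simp add: V_0 del: V.simps)
next
  case (Suc m)
  then have "F q i (q i) \<in> V q (Suc m)" by auto
  then show ?case by (simp only: F_vertex)
qed

text \<open>Harmonic functions on the cells of level \<open>m\<close> are glued. The pieces fit
  because \<open>v\<close> has a single value at each shared midpoint.\<close>

lemma piecewise_harmonic_extension:
  obtains u where "u \<in> dom_energy q" "\<And>x. x \<in> V q m \<Longrightarrow> u x = v x"
    "energy q u = ereal (graph_energy q m v)"
proof -
  have "\<exists>u. u \<in> dom_energy q \<and> (\<forall>x\<in>V q m. u x = v x) \<and> energy q u = ereal (graph_energy q m v)"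
  proof (induction m arbitrary: v)
    case 0
    define u where "u = harmonic (v \<circ> q)"
    have on_V: "\<forall>x\<in>V q 0. u x = v x"
      by (simp add: u_def V_0 harmonic_vertex del: V.simps)
    have "energy q u = ereal (graph_energy q 0 u)"
      unfolding u_def by (rule energy_eq_graph_energy) (rule graph_energy_harmonic)
    also have "graph_energy q 0 u = graph_energy q 0 v"
      using on_V by (intro graph_energy_cong) blast
    finally have "energy q u = ereal (graph_energy q 0 v)" .
    moreover from this have "u \<in> dom_energy q"
      by (simp add: dom_energy_def u_def continuous_on_harmonic)
    ultimately show ?case using on_V by blast
  next
    case (Suc m)
    have "\<exists>g. \<forall>i. g i \<in> dom_energy q \<and> (\<forall>x\<in>V q m. g i x = (v \<circ> F q i) x)
        \<and> energy q (g i) = ereal (graph_energy q m (v \<circ> F q i))"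
      by (rule choice) (use Suc in blast)
    then obtain g where g: "\<And>i. g i \<in> dom_energy q" "\<And>i x. x \<in> V q m \<Longrightarrow> g i x = v (F q i x)"
      "\<And>i. energy q (g i) = ereal (graph_energy q m (v \<circ> F q i))"
      by auto
    have compat: "g i (q j) = g j (q i)" for i j
      by (simp add: g(2) vertex_in_V F_vertex(2)[of q i j])
    have "\<forall>x\<in>V q (Suc m). glue g x = v x"
      using glue_F[of g, OF compat] g(2) V_subset_SG[of m] by auto
    moreover have "energy q (glue g) = ereal (graph_energy q (Suc m) v)"
      by (simp add: energy_glue[of g, OF compat] g(3) graph_energy_Suc)
    moreover have "glue g \<in> dom_energy q"
      by (rule glue_in_dom_energy[of g, OF compat g(1)])
    ultimately show ?case by blast
  qed
  then show ?thesis using that by blast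
qed

section \<open>Conductances\<close>

lemma is_conductances_iff:
  "is_conductances q A c \<longleftrightarrow>
     (\<forall>x y. c x y = c y x) \<and>
     (\<forall>x y. \<not> (x \<in> A \<and> y \<in> A \<and> x \<noteq> y) \<longrightarrow> c x y = 0) \<and>
     (\<forall>a u. least_energy_extension q A a u \<longrightarrow> energy q u = ereal (network_energy c A u))"
  unfolding is_conductances_def network_energy_def ..

lemma is_conductances_commute: "is_conductances q A c \<Longrightarrow> c x y = c y x"
  unfolding is_conductances_iff by iprover

lemma is_conductances_eq_0:
  "is_conductances q A c \<Longrightarrow> \<not> (x \<in> A \<and> y \<in> A \<and> x \<noteq> y) \<Longrightarrow> c x y = 0"
  unfolding is_conductances_iff by iprover

lemma graph_energy_eq_network_energy:
  "graph_energy q m u = network_energy (\<lambda>x y. if adj q m x y then (5/3) ^ m else 0) (V q m) u"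
proof -
  have if_mult: "(if P then k else 0) * r = k * (if P then r else 0)" for P and k r :: real
    by simp
  have "(\<Sum>(x, y)\<in>{(x, y). adj q m x y}. (u x - u y)\<^sup>2)
      = (\<Sum>(x, y)\<in>V q m \<times> V q m. if adj q m x y then (u x - u y)\<^sup>2 else 0)"
    using adj_in_V finite_V by (intro sum.mono_neutral_cong_left) (auto split: if_splits)
  also have "\<dots> = (\<Sum>x\<in>V q m. \<Sum>y\<in>V q m. if adj q m x y then (u x - u y)\<^sup>2 else 0)"
    by (rule sum.cartesian_product[symmetric])
  finally show ?thesis
    by (simp add: graph_energy_def network_energy_def sum_distrib_left if_mult)
qed

text \<open>The candidate is the trace on \<open>A\<close> of the level \<open>k\<close> network.
  Its energy bounds \<open>energy\<close> from below by monotonicity in the level, and the bound is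
  attained by extending a minimizer on \<open>V q k\<close> piecewise harmonically.\<close>

lemma conductances_exist:
  assumes "A \<subseteq> V q k"
  obtains c where "is_conductances q A c" "\<And>a. \<exists>u. least_energy_extension q A a u"
proof -
  define b where "b x y = (if adj q k x y then (5/3) ^ k else (0 :: real))" for x y
  have "b x y = b y x" "0 \<le> b x y" for x y
    by (simp_all add: b_def adj_commute[of k x y])
  with network_trace[OF finite_V assms, of b]
  obtain c where sym: "\<And>x y. c x y = c y x"
    and off: "\<And>x y. \<not> (x \<in> A \<and> y \<in> A \<and> x \<noteq> y) \<Longrightarrow> c x y = 0"
    and le: "\<And>u. network_energy c A u \<le> network_energy b (V q k) u"
    and attain: "\<And>a. \<exists>u. (\<forall>x\<in>A. u x = a x) \<and> network_energy b (V q k) u = network_energy c A a"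
    by blast
  have b: "network_energy b (V q k) u = graph_energy q k u" for u
    unfolding graph_energy_eq_network_energy b_def ..
  have lower: "ereal (network_energy c A u) \<le> energy q u" for u
    using le[of u] graph_energy_le_energy[of k u] unfolding b by (meson ereal_less_eq(3) order_trans)
  have upper: "\<exists>u\<in>dom_energy q. (\<forall>x\<in>A. u x = a x) \<and> energy q u = ereal (network_energy c A a)" for a
  proof -
    obtain v where v: "\<forall>x\<in>A. v x = a x" "graph_energy q k v = network_energy c A a"
      using attain unfolding b by blast
    obtain u where "u \<in> dom_energy q" "\<And>x. x \<in> V q k \<Longrightarrow> u x = v x"
      "energy q u = ereal (graph_energy q k v)"
      using piecewise_harmonic_extension[of k v] by blast
    then show ?thesis
      using v assms by (intro bexI[of _ u]) auto
  qed
  have trace: "network_energy c A u = network_energy c A a" if "\<forall>x\<in>A. u x = a x" for u a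
    using that by (intro network_energy_cong) blast
  show ?thesis
  proof (rule that[of c])
    show "\<exists>u. least_energy_extension q A a u" for a
    proof -
      obtain u where u: "u \<in> dom_energy q" "\<forall>x\<in>A. u x = a x" "energy q u = ereal (network_energy c A a)"
        using upper by blast
      have "energy q u \<le> energy q v" if "\<forall>x\<in>A. v x = a x" for v
        using lower[of v] trace[OF that] u(3) by simp
      then show ?thesis
        using u(1,2) unfolding least_energy_extension_def by blast
    qed
    have "energy q u = ereal (network_energy c A u)" if "least_energy_extension q A a u" for a u
    proof (rule antisym)
      obtain v where v: "v \<in> dom_energy q" "\<forall>x\<in>A. v x = a x" "energy q v = ereal (network_energy c A a)"
        using upper by blast
      have "energy q u \<le> energy q v"
        using that v(1,2) unfolding least_energy_extension_def by blast
      also have "\<dots> = ereal (network_energy c A u)"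
        using that v(3) trace[of u a] unfolding least_energy_extension_def by simp
      finally show "energy q u \<le> ereal (network_energy c A u)" .
    qed (rule lower)
    then show "is_conductances q A c"
      unfolding is_conductances_iff using sym off by blast
  qed
qed

text \<open>\<open>is_conductances\<close> constrains \<open>c\<close> only through minimizers. As
  one exists for every \<open>a\<close>, both quadratic forms agree everywhere, and polarization
  recovers their coefficients.\<close>

lemma is_conductances_unique:
  assumes "A \<subseteq> V q k" and c: "is_conductances q A c" and c': "is_conductances q A c'"
  shows "c = c'"
proof (intro ext)
  fix x y
  have eq: "network_energy c A a = network_energy c' A a" for a
  proof -
    obtain u where u: "least_energy_extension q A a u"
      using conductances_exist[OF assms(1)] by blast
    then have "network_energy c A u = network_energy c' A u"
      using c c' unfolding is_conductances_iff by (metis ereal.inject)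
    moreover have "\<forall>x\<in>A. u x = a x"
      using u unfolding least_energy_extension_def by blast
    then have "network_energy d A u = network_energy d A a" for d
      by (intro network_energy_cong) blast
    ultimately show ?thesis by simp
  qed
  show "c x y = c' x y"
  proof (cases "x \<in> A \<and> y \<in> A \<and> x \<noteq> y")
    case True
    then show ?thesis
      using network_energy_inject[OF finite_subset[OF assms(1) finite_V] eq
          is_conductances_commute[OF c] is_conductances_commute[OF c']] by blast
  next
    case False
    then show ?thesis
      by (simp only: is_conductances_eq_0[OF c False] is_conductances_eq_0[OF c' False])
  qed
qed

lemma conductance_eqI:
  assumes "A \<subseteq> V q k" "is_conductances q A c"
  shows "conductance q A = c"
  unfolding conductance_def using assms is_conductances_unique by (intro the_equality)

lemma is_conductances_conductance:
  assumes "A \<subseteq> V q k"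
  shows "is_conductances q A (conductance q A)"
proof -
  obtain c where "is_conductances q A c"
    using conductances_exist[OF assms] by blast
  then show ?thesis
    using conductance_eqI[OF assms] by simp
qed

section \<open>Conductances of the union of three copies\<close>

text \<open>
  If some \<open>u \<circ> F q i\<close> were not minimal, replacing it by a better competitor on that cell alone would
  lower the energy of \<open>u\<close>; the competitor fits because \<open>A\<close> contains all three corners.
\<close>

lemma least_energy_extension_F:
  assumes A: "range q \<subseteq> A" "A \<subseteq> V q k"
    and u: "least_energy_extension q (\<Union>i. F q i ` A) a u"
  shows "least_energy_extension q A (a \<circ> F q i) (u \<circ> F q i)"
proof -
  have dom: "u \<circ> F q j \<in> dom_energy q" for j
    using u dom_energy_iff unfolding least_energy_extension_def by blast
  have on_A: "u (F q j x) = a (F q j x)" if "x \<in> A" for j x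
    using u that unfolding least_energy_extension_def by blast
  have "energy q (u \<circ> F q i) \<le> energy q v" if v: "v \<in> dom_energy q" "\<forall>x\<in>A. v x = (a \<circ> F q i) x" for v
  proof -
    define g where "g j = (if j = i then v else u \<circ> F q j)" for j
    have g_A: "g j x = a (F q j x)" if "x \<in> A" for j x
      using that v(2) on_A by (simp add: g_def)
    have compat: "g j (q l) = g l (q j)" for j l
      using A(1) by (simp add: g_A range_subsetD F_vertex(2)[of q j l])
    have "glue g \<in> dom_energy q"
      by (rule glue_in_dom_energy[of g, OF compat]) (simp add: g_def v(1) dom)
    moreover have "\<forall>x\<in>(\<Union>i. F q i ` A). glue g x = a x"
      using glue_F[of g, OF compat] g_A A(2) V_subset_SG[of k] by auto
    ultimately have "energy q u \<le> energy q (glue g)"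
      using u unfolding least_energy_extension_def by blast
    then have le: "(\<Sum>j\<in>UNIV. energy q (u \<circ> F q j)) \<le> (\<Sum>j\<in>UNIV. energy q (g j))"
      unfolding energy_self_similar[of u] energy_glue[of g, OF compat]
      by (subst (asm) ereal_mult_le_mult_iff) auto
    \<comment> \<open>All energies here are finite; passing to reals allows the equal terms of the
      other two cells to be cancelled.\<close>
    define e where "e w = real_of_ereal (energy q w)" for w
    have e: "energy q w = ereal (e w)" if "w \<in> dom_energy q" for w
      using that energy_nonneg[of w] by (auto simp: dom_energy_def e_def ereal_real)
    have "g j \<in> dom_energy q" for j
      by (simp add: g_def v(1) dom)
    then have "(\<Sum>j\<in>UNIV. e (u \<circ> F q j)) \<le> (\<Sum>j\<in>UNIV. e (g j))"
      using le by (simp add: e dom)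
    moreover have "(\<Sum>j\<in>UNIV - {i}. e (g j)) = (\<Sum>j\<in>UNIV - {i}. e (u \<circ> F q j))"
      by (intro sum.cong) (auto simp: g_def)
    ultimately show ?thesis
      by (simp add: sum.remove[of UNIV i] e v(1) dom g_def)
  qed
  then show ?thesis
    unfolding least_energy_extension_def using dom on_A by auto
qed

text \<open>\<open>c i\<close> transports the conductances of \<open>A\<close> to cell
  \<open>i\<close>, with 0 elsewhere. A minimizer restricts to minimizers on the cells, so its
  energy is 5/3 times the sum of the three cell forms.\<close>

lemma is_conductances_Union:
  assumes A: "range q \<subseteq> A" "A \<subseteq> V q k"
  defines "c \<equiv> (\<lambda>i x y. if x \<in> F q i ` A \<and> y \<in> F q i ` A
      then conductance q A (2 *\<^sub>R x - q i) (2 *\<^sub>R y - q i) else 0)"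
  shows "is_conductances q (\<Union>i. F q i ` A) (\<lambda>x y. 5/3 * (\<Sum>i\<in>UNIV. c i x y))"
proof -
  let ?A = "\<Union>i. F q i ` A"
  have cond: "is_conductances q A (conductance q A)"
    by (rule is_conductances_conductance[OF A(2)])
  have fin: "finite A"
    using A(2) finite_V finite_subset by blast
  have c_sym: "c i x y = c i y x" for i x y
    using cond unfolding c_def is_conductances_iff by auto
  have c_off: "c i x y = 0" if "\<not> (x \<in> ?A \<and> y \<in> ?A \<and> x \<noteq> y)" for i x y
    using that cond unfolding c_def is_conductances_iff by auto
  have c_energy: "network_energy (c i) ?A u = network_energy (conductance q A) A (u \<circ> F q i)" for i u
  proof -
    have inj: "inj_on (F q i) A"
      using inj_F by (rule inj_on_subset) simp
    have "(\<Sum>x\<in>?A. \<Sum>y\<in>?A. c i x y * (u x - u y)\<^sup>2)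
        = (\<Sum>x\<in>F q i ` A. \<Sum>y\<in>?A. c i x y * (u x - u y)\<^sup>2)"
      using fin by (intro sum.mono_neutral_right) (auto simp: c_def)
    also have "\<dots> = (\<Sum>x\<in>F q i ` A. \<Sum>y\<in>F q i ` A. c i x y * (u x - u y)\<^sup>2)"
      using fin by (intro sum.cong[OF refl] sum.mono_neutral_right) (auto simp: c_def)
    also have "\<dots> = (\<Sum>x\<in>A. \<Sum>y\<in>A. conductance q A x y * ((u \<circ> F q i) x - (u \<circ> F q i) y)\<^sup>2)"
      unfolding sum.reindex[OF inj] by (simp add: c_def F_inverse)
    finally show ?thesis
      by (simp add: network_energy_def)
  qed
  have total: "network_energy (\<lambda>x y. 5/3 * (\<Sum>i\<in>UNIV. c i x y)) ?A u
      = 5/3 * (\<Sum>i\<in>UNIV. network_energy (c i) ?A u)" for u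
    by (simp add: network_energy_def sum_3' sum.distrib sum_distrib_left distrib_left distrib_right
        mult.assoc add_divide_distrib)
  have "energy q u = ereal (network_energy (\<lambda>x y. 5/3 * (\<Sum>i\<in>UNIV. c i x y)) ?A u)"
    if "least_energy_extension q ?A a u" for a u
  proof -
    have "energy q (u \<circ> F q i) = ereal (network_energy (conductance q A) A (u \<circ> F q i))" for i
      using least_energy_extension_F[OF A that] cond unfolding is_conductances_iff by blast
    then show ?thesis
      unfolding total c_energy energy_self_similar[of u] by simp
  qed
  moreover have "(\<Sum>i\<in>UNIV. c i x y) = (\<Sum>i\<in>UNIV. c i y x)" for x y
    by (intro sum.cong c_sym refl)
  ultimately show ?thesis
    unfolding is_conductances_iff using c_off by auto
qed

text \<open>Two distinct points of one cell cannot both lie in another, since two cells share at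
  most one point; only the summand of cell \<open>i\<close> survives.\<close>

lemma conductance_Union_F:
  assumes A: "range q \<subseteq> A" "A \<subseteq> V q k" and xy: "x \<in> A" "y \<in> A" "x \<noteq> y"
  shows "conductance q (\<Union>i. F q i ` A) (F q i x) (F q i y) = 5/3 * conductance q A x y"
proof -
  have subset: "(\<Union>i. F q i ` A) \<subseteq> V q (Suc k)"
    using A(2) by auto
  have one_cell: "\<not> (F q i x \<in> F q j ` A \<and> F q i y \<in> F q j ` A)" if "j \<noteq> i" for j
  proof
    assume "F q i x \<in> F q j ` A \<and> F q i y \<in> F q j ` A"
    then obtain x' y' where "x' \<in> A" "y' \<in> A" "F q i x = F q j x'" "F q i y = F q j y'"
      by blast
    moreover have "A \<subseteq> SG q"
      using A(2) V_subset_SG by blast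
    ultimately have "x = q j" "y = q j"
      using SG_F_eq_F_imp(1) xy that by blast+
    then show False using xy(3) by simp
  qed
  have "(\<Sum>j\<in>UNIV. if F q i x \<in> F q j ` A \<and> F q i y \<in> F q j ` A
      then conductance q A (2 *\<^sub>R F q i x - q j) (2 *\<^sub>R F q i y - q j) else 0)
    = (\<Sum>j\<in>UNIV. if j = i then conductance q A x y else 0)"
    using one_cell xy by (intro sum.cong) (auto simp: F_inverse)
  then show ?thesis
    by (simp add: conductance_eqI[OF subset is_conductances_Union[OF A]])
qed

text \<open>Some summand must be nonzero, and its index is the cell containing both points.\<close>

lemma conductance_Union_nonzero:
  assumes A: "range q \<subseteq> A" "A \<subseteq> V q k" and "conductance q (\<Union>i. F q i ` A) x y \<noteq> 0"
  obtains i x' y' where "x = F q i x'" "y = F q i y'" "conductance q A x' y' \<noteq> 0"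
proof -
  have subset: "(\<Union>i. F q i ` A) \<subseteq> V q (Suc k)"
    using A(2) by auto
  have "\<exists>i. (if x \<in> F q i ` A \<and> y \<in> F q i ` A
      then conductance q A (2 *\<^sub>R x - q i) (2 *\<^sub>R y - q i) else 0) \<noteq> 0"
  proof (rule ccontr)
    assume "\<not> ?thesis"
    then have "conductance q (\<Union>i. F q i ` A) x y = 0"
      unfolding conductance_eqI[OF subset is_conductances_Union[OF A]] by (simp only: not_not not_ex) simp
    then show False using assms(3) by simp
  qed
  then obtain i where "x \<in> F q i ` A" "y \<in> F q i ` A"
    "conductance q A (2 *\<^sub>R x - q i) (2 *\<^sub>R y - q i) \<noteq> 0"
    by (auto split: if_splits)
  moreover have "x = F q i (2 *\<^sub>R x - q i)" "y = F q i (2 *\<^sub>R y - q i)"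
    by (simp_all add: F_def)
  ultimately show ?thesis
    using that by blast
qed

section \<open>The sets \<open>beta q m\<close>\<close>

lemma beta_subset_V: "beta q m \<subseteq> V q (m + 2)"
proof (induction m)
  case 0
  have "F q i (F q j (q l)) \<in> V q 2" for i j l
    using vertex_in_V[of l 0] unfolding numeral_2_eq_2 V.simps(2) by blast
  then show ?case
    using vertex_in_V[of _ 2] unfolding add_0 beta.simps by blast
next
  case (Suc m)
  then show ?case
    unfolding beta.simps(2) add_Suc V.simps(2) by blast
qed

text \<open>Each corner is fixed by its own map and so persists. This supplies the corner hypothesis
  on which the gluing argument depends.\<close>

lemma vertices_subset_beta: "range q \<subseteq> beta q m"
proof (induction m)
  case 0
  then show ?case by (simp add: UNIV_3')
next
  case (Suc m)
  have "F q i (q i) \<in> beta q (Suc m)" for i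
    unfolding beta.simps(2) using Suc by blast
  then show ?case by (auto simp only: F_vertex)
qed

lemma beta_subset_SG: "beta q m \<subseteq> SG q"
  using beta_subset_V V_subset_SG by blast

lemma Fword_beta: "x \<in> beta q 0 \<Longrightarrow> Fword q w x \<in> beta q (length w)"
  by (induction w) auto

lemma inj_Fword: "inj (Fword q w)"
  by (induction w) (simp_all add: inj_compose inj_F del: comp_apply)

text \<open>The vanishing claim in contrapositive form, which suits induction: a nonzero conductance
  descends to a nonzero one a level lower, and the cell index met on the way becomes the first
  letter of the word.\<close>

lemma conductance_beta_nonzero:
  assumes "conductance q (beta q m) x y \<noteq> 0"
  shows "\<exists>w. length w = m \<and> x \<in> cell q w \<and> y \<in> cell q w"
  using assms
proof (induction m arbitrary: x y)
  case 0
  then have "x \<in> beta q 0 \<and> y \<in> beta q 0"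
    using is_conductances_conductance[OF beta_subset_V[of 0]] unfolding is_conductances_iff by blast
  then show ?case
    using beta_subset_SG[of 0] by (auto simp: cell_def simp del: beta.simps)
next
  case (Suc m)
  obtain i x' y' where *: "x = F q i x'" "y = F q i y'" "conductance q (beta q m) x' y' \<noteq> 0"
    by (rule conductance_Union_nonzero[OF vertices_subset_beta beta_subset_V])
      (rule Suc.prems[unfolded beta.simps])
  then obtain w where "length w = m" "x' \<in> cell q w" "y' \<in> cell q w"
    using Suc.IH by blast
  then show ?case
    using * by (intro exI[of _ "i # w"]) (auto simp: cell_def)
qed

text \<open>Each letter contributes one factor 5/3; injectivity of \<open>Fword q w\<close> keeps
  the two points distinct throughout.\<close>

lemma conductance_beta_Fword:
  assumes "x \<in> beta q 0" "y \<in> beta q 0" "x \<noteq> y"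
  shows "conductance q (beta q (length w)) (Fword q w x) (Fword q w y)
    = (5/3) ^ length w * conductance q (beta q 0) x y"
proof (induction w)
  case (Cons i w)
  have "Fword q w x \<noteq> Fword q w y"
    using assms(3) inj_Fword by (auto dest: injD)
  then have "conductance q (\<Union>i. F q i ` beta q (length w)) (F q i (Fword q w x)) (F q i (Fword q w y))
    = 5/3 * conductance q (beta q (length w)) (Fword q w x) (Fword q w y)"
    using assms by (intro conductance_Union_F[OF vertices_subset_beta beta_subset_V] Fword_beta)
  then show ?case by (simp add: Cons del: beta.simps(1))
qed simp

end

theorem lemma2p13:
  fixes q :: "3 \<Rightarrow> real^2" and m :: nat and x y :: "real^2"
  assumes "equilateral q"
    and "m > 0"
    and "x \<in> beta q m" and "y \<in> beta q m" and "x \<noteq> y"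
  shows "(\<not> (\<exists>w. length w = m \<and> x \<in> cell q w \<and> y \<in> cell q w) \<longrightarrow>
            conductance q (beta q m) x y = 0) \<and>
         (\<forall>w xt yt. length w = m \<and> xt \<in> beta q 0 \<and> yt \<in> beta q 0 \<and>
              x = Fword q w xt \<and> y = Fword q w yt \<longrightarrow>
            conductance q (beta q m) x y = (5/3) ^ m * conductance q (beta q 0) xt yt)"
proof -
  interpret gasket q
    using assms(1) by (rule gasket.intro)
  show ?thesis
    using conductance_beta_nonzero conductance_beta_Fword assms(5) by blast
qed

end
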